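(* Let $(L,[\cdot,\cdot],\{\cdot,\cdot\},\alpha)$ be a compatible Hom-Leibniz algebra and let $N:L\to L$ be a Nijenhuis operator on it. Define, for $x,y\in L$, $$\mu_1(x,y)=[x,N(y)]+[N(x),y]-N[x,y],\qquad m_1(x,y)=\{x,N(y)\}+\{N(x),y\}-N\{x,y\}.$$ Then $(\mu_1,m_1)$ generates an infinitesimal deformation of $(L,[\cdot,\cdot],\{\cdot,\cdot\},\alpha)$, and this deformation is trivial.
   Context: $K$ is a field of characteristic $0$. Hom-Leibniz algebra: a triple $(L,[\cdot,\cdot],\alpha)$ with $L$ a $K$-vector space, $[\cdot,\cdot]:L\otimes L\to L$ and $\alpha:L\to L$ linear, such that $[\alpha(x),[y,z]]=[[x,y],\alpha(z)]+[\alpha(y),[x,z]]$ for all $x,y,z\in L$. All Hom-Leibniz algebras are assumed multiplicative: $\alpha([x,y])=[\alpha(x),\alpha(y)]$. Compatible Hom-Leibniz algebra: a quadruple $(L,[\cdot,\cdot],\{\cdot,\cdot\},\alpha)$ such that $(L,[\cdot,\cdot],\alpha)$ and $(L,\{\cdot,\cdot\},\alpha)$ are Hom-Leibniz algebras and for all $x,y,z\in L$ $$[\alpha(x),\{y,z\}]+\{\alpha(x),[y,z]\}=[\{x,y\},\alpha(z)]+\{[x,y],\alpha(z)\}+[\alpha(y),\{x,z\}]+\{\alpha(y),[x,z]\}.$$ A homomorphism $(L_1,[\cdot,\cdot]_1,\{\cdot,\cdot\}_1,\alpha_1)\to(L_2,[\cdot,\cdot]_2,\{\cdot,\cdot\}_2,\alpha_2)$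 is a linear map $\phi:L_1\to L_2$ with $\phi([x,y]_1)=[\phi(x),\phi(y)]_2$, $\phi(\{x,y\}_1)=\{\phi(x),\phi(y)\}_2$ and $\phi\circ\alpha_1=\alpha_2\circ\phi$. Infinitesimal deformation: write $\mu_0(x,y)=[x,y]$, $m_0(x,y)=\{x,y\}$, and let $\mathbb C_\alpha^2(L,L)=\{f\in\mathrm{Hom}(L\otimes L,L)\mid\alpha\circ f=f\circ\alpha^{\otimes2}\}$. For $\mu_1,m_1\in\mathbb C_\alpha^2(L,L)$ put $\mu_t(x,y)=\mu_0(x,y)+t\mu_1(x,y)$ and $m_t(x,y)=m_0(x,y)+tm_1(x,y)$. If $(L,\mu_t,m_t,\alpha)$ is a compatible Hom-Leibniz algebra for every $t$ (in $K$), then $(\mu_1,m_1)$ is said to generate the infinitesimal deformation $(L,\mu_t,m_t,\alpha)$ of $(L,\mu_0,m_0,\alpha)$. It is trivial if there is a linear map $N:L\to L$ (independent of $t$) such that $\mathrm{Id}+tN:(L,\mu_t,m_t,\alpha)\to(L,\mu_0,m_0,\alpha)$ is a homomorphism of compatible Hom-Leibniz algebras for every $t$. Nijenhuis operator: a linear map $N:L\to L$ is a Nijenhuis operator on a Hom-Leibniz algebra $(L,[\cdot,\cdot],\alpha)$ if $N\alpha=\alpha N$ and $N([x,N(y)]+[N(x),y]-N[x,y])=[N(x),N(y)]$ for all $x,y\in L$. It is a Nijenhuis operator on a compatible Hom-Leibniz algebra $(L,[\cdot,\cdot],\{\cdot,\cdot\},\alpha)$ if it is a Nijenhuis operator on both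 $(L,[\cdot,\cdot],\alpha)$ and $(L,\{\cdot,\cdot\},\alpha)$. *)

theory Defs
  imports Complex_Main
begin

text \<open>
  The ground field is the type \<^typ>\<open>'k\<close> of class \<^class>\<open>field_char_0\<close>, and the vector space \<open>L\<close>
  is a type \<^typ>\<open>'a\<close> with scalar multiplication \<open>s\<close>. A linear map
  out of \<open>L \<otimes> L\<close> is given as a curried map that is linear in each argument.
\<close>

definition bilinear_on_space ::
    "('k::field_char_0 \<Rightarrow> 'a::ab_group_add \<Rightarrow> 'a) \<Rightarrow> ('a \<Rightarrow> 'a \<Rightarrow> 'a) \<Rightarrow> bool" where
  "bilinear_on_space s f \<longleftrightarrow>
     (\<forall>x. Vector_Spaces.linear s s (\<lambda>y. f x y)) \<and> (\<forall>y. Vector_Spaces.linear s s (\<lambda>x. f x y))"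

locale hom_leibniz_algebra = vector_space s
  for s :: "'k::field_char_0 \<Rightarrow> 'a::ab_group_add \<Rightarrow> 'a" +
  fixes br :: "'a \<Rightarrow> 'a \<Rightarrow> 'a" and \<alpha> :: "'a \<Rightarrow> 'a"
  assumes bilinear_bracket: "bilinear_on_space s br"
    and linear_twist: "Vector_Spaces.linear s s \<alpha>"
    and hom_leibniz: "br (\<alpha> x) (br y z) = br (br x y) (\<alpha> z) + br (\<alpha> y) (br x z)"
    and multiplicative: "\<alpha> (br x y) = br (\<alpha> x) (\<alpha> y)"

locale compatible_hom_leibniz_algebra =
  first: hom_leibniz_algebra s br \<alpha> + second: hom_leibniz_algebra s cbr \<alpha>
  for s :: "'k::field_char_0 \<Rightarrow> 'a::ab_group_add \<Rightarrow> 'a"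
    and br cbr :: "'a \<Rightarrow> 'a \<Rightarrow> 'a" and \<alpha> :: "'a \<Rightarrow> 'a" +
  assumes compatible:
    "br (\<alpha> x) (cbr y z) + cbr (\<alpha> x) (br y z) =
       br (cbr x y) (\<alpha> z) + cbr (br x y) (\<alpha> z) + br (\<alpha> y) (cbr x z) + cbr (\<alpha> y) (br x z)"

locale compatible_hom_leibniz_hom =
  source: compatible_hom_leibniz_algebra s1 br1 cbr1 \<alpha>1 +
  target: compatible_hom_leibniz_algebra s2 br2 cbr2 \<alpha>2
  for s1 :: "'k::field_char_0 \<Rightarrow> 'a::ab_group_add \<Rightarrow> 'a"
    and br1 cbr1 :: "'a \<Rightarrow> 'a \<Rightarrow> 'a" and \<alpha>1 :: "'a \<Rightarrow> 'a"
    and s2 :: "'k \<Rightarrow> 'b::ab_group_add \<Rightarrow> 'b"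
    and br2 cbr2 :: "'b \<Rightarrow> 'b \<Rightarrow> 'b" and \<alpha>2 :: "'b \<Rightarrow> 'b" +
  fixes \<phi> :: "'a \<Rightarrow> 'b"
  assumes linear_hom: "Vector_Spaces.linear s1 s2 \<phi>"
    and hom_first: "\<phi> (br1 x y) = br2 (\<phi> x) (\<phi> y)"
    and hom_second: "\<phi> (cbr1 x y) = cbr2 (\<phi> x) (\<phi> y)"
    and hom_twist: "\<phi> \<circ> \<alpha>1 = \<alpha>2 \<circ> \<phi>"

definition two_cochains ::
    "('k::field_char_0 \<Rightarrow> 'a::ab_group_add \<Rightarrow> 'a) \<Rightarrow> ('a \<Rightarrow> 'a) \<Rightarrow> ('a \<Rightarrow> 'a \<Rightarrow> 'a) set" where
  "two_cochains s \<alpha> = {f. bilinear_on_space s f \<and> (\<forall>x y. \<alpha> (f x y) = f (\<alpha> x) (\<alpha> y))}"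

definition deformed_bracket ::
    "('k::field_char_0 \<Rightarrow> 'a::ab_group_add \<Rightarrow> 'a) \<Rightarrow> ('a \<Rightarrow> 'a \<Rightarrow> 'a) \<Rightarrow> ('a \<Rightarrow> 'a \<Rightarrow> 'a)
      \<Rightarrow> 'k \<Rightarrow> 'a \<Rightarrow> 'a \<Rightarrow> 'a" where
  "deformed_bracket s f0 f1 t x y = f0 x y + s t (f1 x y)"

definition generates_infinitesimal_deformation ::
    "('k::field_char_0 \<Rightarrow> 'a::ab_group_add \<Rightarrow> 'a) \<Rightarrow> ('a \<Rightarrow> 'a \<Rightarrow> 'a) \<Rightarrow> ('a \<Rightarrow> 'a \<Rightarrow> 'a)
      \<Rightarrow> ('a \<Rightarrow> 'a) \<Rightarrow> ('a \<Rightarrow> 'a \<Rightarrow> 'a) \<Rightarrow> ('a \<Rightarrow> 'a \<Rightarrow> 'a) \<Rightarrow> bool" where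
  "generates_infinitesimal_deformation s \<mu>0 m0 \<alpha> \<mu>1 m1 \<longleftrightarrow>
     compatible_hom_leibniz_algebra s \<mu>0 m0 \<alpha> \<and>
     \<mu>1 \<in> two_cochains s \<alpha> \<and> m1 \<in> two_cochains s \<alpha> \<and>
     (\<forall>t. compatible_hom_leibniz_algebra s
            (deformed_bracket s \<mu>0 \<mu>1 t) (deformed_bracket s m0 m1 t) \<alpha>)"

definition trivial_infinitesimal_deformation ::
    "('k::field_char_0 \<Rightarrow> 'a::ab_group_add \<Rightarrow> 'a) \<Rightarrow> ('a \<Rightarrow> 'a \<Rightarrow> 'a) \<Rightarrow> ('a \<Rightarrow> 'a \<Rightarrow> 'a)
      \<Rightarrow> ('a \<Rightarrow> 'a) \<Rightarrow> ('a \<Rightarrow> 'a \<Rightarrow> 'a) \<Rightarrow> ('a \<Rightarrow> 'a \<Rightarrow> 'a) \<Rightarrow> bool" where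
  "trivial_infinitesimal_deformation s \<mu>0 m0 \<alpha> \<mu>1 m1 \<longleftrightarrow>
     (\<exists>N. Vector_Spaces.linear s s N \<and>
        (\<forall>t. compatible_hom_leibniz_hom s
               (deformed_bracket s \<mu>0 \<mu>1 t) (deformed_bracket s m0 m1 t) \<alpha>
               s \<mu>0 m0 \<alpha> (\<lambda>x. x + s t (N x))))"

definition nijenhuis_operator ::
    "('k::field_char_0 \<Rightarrow> 'a::ab_group_add \<Rightarrow> 'a) \<Rightarrow> ('a \<Rightarrow> 'a \<Rightarrow> 'a) \<Rightarrow> ('a \<Rightarrow> 'a)
      \<Rightarrow> ('a \<Rightarrow> 'a) \<Rightarrow> bool" where
  "nijenhuis_operator s br \<alpha> N \<longleftrightarrow>
     Vector_Spaces.linear s s N \<and> N \<circ> \<alpha> = \<alpha> \<circ> N \<and>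
     (\<forall>x y. N (br x (N y) + br (N x) y - N (br x y)) = br (N x) (N y))"

definition compatible_nijenhuis_operator ::
    "('k::field_char_0 \<Rightarrow> 'a::ab_group_add \<Rightarrow> 'a) \<Rightarrow> ('a \<Rightarrow> 'a \<Rightarrow> 'a) \<Rightarrow> ('a \<Rightarrow> 'a \<Rightarrow> 'a)
      \<Rightarrow> ('a \<Rightarrow> 'a) \<Rightarrow> ('a \<Rightarrow> 'a) \<Rightarrow> bool" where
  "compatible_nijenhuis_operator s br cbr \<alpha> N \<longleftrightarrow>
     nijenhuis_operator s br \<alpha> N \<and> nijenhuis_operator s cbr \<alpha> N"

end

theory Submission
  imports Defs
begin

text \<open>
  For brackets \<open>f, g\<close> let \<open>A(f,g)\<close> be the Leibniz defect of \<open>f\<close> composed with \<open>g\<close>; compatibility of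
  \<open>f\<close> and \<open>g\<close> says \<open>A(f,g) + A(g,f) = 0\<close>. Write \<open>f\<^sub>N(x,y) = f(x,Ny) + f(Nx,y) - N f(x,y)\<close>. As \<open>f \<mapsto> f\<^sub>N\<close>
  is the infinitesimal action of \<open>N\<close>, the defect \<open>A(f\<^sub>N,g) + A(f,g\<^sub>N)\<close> is the image of \<open>A(f,g)\<close> under that
  action, and the Nijenhuis identity makes \<open>A(f\<^sub>N,g\<^sub>N)\<close> a linear expression in \<open>A(f,g)\<close> as well. Hence
  the defect of the deformed brackets is the image of the original one under a linear operator
  that does not depend on the brackets, so all identities survive the deformation.
\<close>

section \<open>Leibniz defects and the operators acting on them\<close>

definition leibniz_defect ::
    "('a \<Rightarrow> 'a) \<Rightarrow> ('a \<Rightarrow> 'a \<Rightarrow> 'a) \<Rightarrow> ('a \<Rightarrow> 'a \<Rightarrow> 'a) \<Rightarrow> 'a \<Rightarrow> 'a \<Rightarrow> 'a \<Rightarrow> 'a::ab_group_add" where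
  "leibniz_defect \<alpha> f g x y z = f (\<alpha> x) (g y z) - f (g x y) (\<alpha> z) - f (\<alpha> y) (g x z)"

definition nijenhuis_bracket ::
    "('a \<Rightarrow> 'a) \<Rightarrow> ('a \<Rightarrow> 'a \<Rightarrow> 'a) \<Rightarrow> 'a \<Rightarrow> 'a \<Rightarrow> 'a::ab_group_add" where
  "nijenhuis_bracket N f x y = f x (N y) + f (N x) y - N (f x y)"

definition defect_action ::
    "('a \<Rightarrow> 'a) \<Rightarrow> ('a \<Rightarrow> 'a \<Rightarrow> 'a \<Rightarrow> 'a) \<Rightarrow> 'a \<Rightarrow> 'a \<Rightarrow> 'a \<Rightarrow> 'a::ab_group_add" where
  "defect_action N T x y z = T (N x) y z + T x (N y) z + T x y (N z) - N (T x y z)"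

text \<open>With \<open>defect_action\<close> as the coefficient of t, this is the coefficient of
  t^2 in the formal expansion of (Id + tN)^(-1) T((Id + tN)x, (Id + tN)y, (Id + tN)z), the transport
  of a trilinear map \<open>T\<close> along Id + tN.\<close>

definition defect_action2 ::
    "('a \<Rightarrow> 'a) \<Rightarrow> ('a \<Rightarrow> 'a \<Rightarrow> 'a \<Rightarrow> 'a) \<Rightarrow> 'a \<Rightarrow> 'a \<Rightarrow> 'a \<Rightarrow> 'a::ab_group_add" where
  "defect_action2 N T x y z = T x (N y) (N z) + T (N x) y (N z) + T (N x) (N y) z
     - N (T (N x) y z) - N (T x (N y) z) - N (T x y (N z)) + N (N (T x y z))"

section \<open>Computation rules for linear and bilinear maps\<close>

lemma linear_endo_simps:
  assumes "Vector_Spaces.linear s s f"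
  shows "f (x + y) = f x + f y" "f (x - y) = f x - f y" "f 0 = 0" "f (s c x) = s c (f x)"
proof -
  interpret Vector_Spaces.linear s s f by fact
  show "f (x + y) = f x + f y" "f (x - y) = f x - f y" "f 0 = 0" "f (s c x) = s c (f x)"
    by (rule add diff zero scale)+
qed

lemma bilinear_on_space_simps:
  assumes "bilinear_on_space s f"
  shows "f x (y + z) = f x y + f x z" "f (x + y) z = f x z + f y z"
    "f x (y - z) = f x y - f x z" "f (x - y) z = f x z - f y z"
    "f x (s c y) = s c (f x y)" "f (s c x) y = s c (f x y)"
proof -
  have l: "Vector_Spaces.linear s s (\<lambda>y. f x y)" and r: "Vector_Spaces.linear s s (\<lambda>x. f x y)" for x y
    using assms by (auto simp: bilinear_on_space_def)
  show "f x (y + z) = f x y + f x z" "f (x + y) z = f x z + f y z"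
    "f x (y - z) = f x y - f x z" "f (x - y) z = f x z - f y z"
    "f x (s c y) = s c (f x y)" "f (s c x) y = s c (f x y)"
    using linear_endo_simps[OF l] linear_endo_simps[OF r] by auto
qed

lemma bilinear_on_spaceI:
  assumes "vector_space s"
    and "\<And>x y z. f x (y + z) = f x y + f x z" "\<And>x y z. f (x + y) z = f x z + f y z"
    and "\<And>c x y. f x (s c y) = s c (f x y)" "\<And>c x y. f (s c x) y = s c (f x y)"
  shows "bilinear_on_space s f"
  using assms by (simp add: bilinear_on_space_def Vector_Spaces.linear_iff)

lemma bilinear_nijenhuis_bracket:
  assumes "vector_space s" "Vector_Spaces.linear s s N" "bilinear_on_space s f"
  shows "bilinear_on_space s (nijenhuis_bracket N f)"
proof -
  interpret vector_space s by fact
  show ?thesis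
    by (rule bilinear_on_spaceI)
      (simp_all add: assms(1) nijenhuis_bracket_def linear_endo_simps[OF assms(2)]
        bilinear_on_space_simps[OF assms(3)] scale_right_distrib scale_right_diff_distrib)
qed

lemma bilinear_deformed_bracket:
  assumes "vector_space s" "bilinear_on_space s f" "bilinear_on_space s g"
  shows "bilinear_on_space s (deformed_bracket s f g t)"
proof -
  interpret vector_space s by fact
  show ?thesis
    by (rule bilinear_on_spaceI)
      (simp_all add: assms(1) deformed_bracket_def bilinear_on_space_simps[OF assms(2)]
        bilinear_on_space_simps[OF assms(3)] scale_right_distrib mult.commute)
qed

section \<open>The Leibniz defect of deformed brackets, by powers of t\<close>

lemma leibniz_defect_deformed_bracket:
  assumes "vector_space s" and f: "bilinear_on_space s f" "bilinear_on_space s f1"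
  shows "leibniz_defect \<alpha> (deformed_bracket s f f1 t) (deformed_bracket s g g1 t) x y z =
    leibniz_defect \<alpha> f g x y z
    + s t (leibniz_defect \<alpha> f1 g x y z + leibniz_defect \<alpha> f g1 x y z)
    + s t (s t (leibniz_defect \<alpha> f1 g1 x y z))"
proof -
  interpret vector_space s by fact
  show ?thesis
    by (simp add: leibniz_defect_def deformed_bracket_def bilinear_on_space_simps[OF f(1)]
        bilinear_on_space_simps[OF f(2)] scale_right_distrib scale_right_diff_distrib algebra_simps)
qed

text \<open>Applying N to the value of the inner bracket \<open>g\<close> contributes with sign plus
  through the outer \<open>nijenhuis_bracket N f\<close> and with sign minus through the inner
  \<open>nijenhuis_bracket N g\<close>, so these terms cancel. What remains has N on one of x, y, z
  or outside, once N is moved past \<alpha>.\<close>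

lemma leibniz_defect_nijenhuis_bracket_first_order:
  assumes "Vector_Spaces.linear s s N" "N \<circ> \<alpha> = \<alpha> \<circ> N" "bilinear_on_space s f"
  shows "leibniz_defect \<alpha> (nijenhuis_bracket N f) g x y z
      + leibniz_defect \<alpha> f (nijenhuis_bracket N g) x y z
    = defect_action N (leibniz_defect \<alpha> f g) x y z"
proof -
  have "N (\<alpha> u) = \<alpha> (N u)" for u using assms(2) by (metis comp_apply)
  then show ?thesis
    by (simp add: leibniz_defect_def nijenhuis_bracket_def defect_action_def
        linear_endo_simps[OF assms(1)] bilinear_on_space_simps[OF assms(3)])
qed

text \<open>The Nijenhuis identity enters twice: for \<open>g\<close> it evaluates N on the inner
  bracket, for \<open>f\<close> it removes the term in which both arguments of \<open>f\<close> lie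
  under N.\<close>

lemma leibniz_defect_nijenhuis_bracket_second_order:
  assumes f: "bilinear_on_space s f" "nijenhuis_operator s f \<alpha> N"
    and g: "nijenhuis_operator s g \<alpha> N"
  shows "leibniz_defect \<alpha> (nijenhuis_bracket N f) (nijenhuis_bracket N g) x y z
    = defect_action2 N (leibniz_defect \<alpha> f g) x y z"
proof -
  have lin: "Vector_Spaces.linear s s N" using f(2) by (simp add: nijenhuis_operator_def)
  have comm: "N (\<alpha> u) = \<alpha> (N u)" for u
    using f(2) by (auto simp: nijenhuis_operator_def fun_eq_iff)
  note nl = linear_endo_simps[OF lin]
  have ng: "N (nijenhuis_bracket N g u v) = g (N u) (N v)" for u v
    using g by (simp add: nijenhuis_operator_def nijenhuis_bracket_def)
  have nf: "f (N u) (N v) = N (f u (N v)) + N (f (N u) v) - N (N (f u v))" for u v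
    using f(2) by (simp add: nijenhuis_operator_def flip: nl(1,2))
  have l: "nijenhuis_bracket N f (\<alpha> u) (nijenhuis_bracket N g v w)
    = f (\<alpha> u) (g (N v) (N w)) + f (\<alpha> (N u)) (g v (N w)) + f (\<alpha> (N u)) (g (N v) w)
      - N (f (\<alpha> (N u)) (g v w)) - N (f (\<alpha> u) (g v (N w))) - N (f (\<alpha> u) (g (N v) w))
      + N (N (f (\<alpha> u) (g v w)))" for u v w
  proof -
    have "nijenhuis_bracket N f (\<alpha> u) (nijenhuis_bracket N g v w) =
       f (\<alpha> u) (g (N v) (N w)) + f (N (\<alpha> u)) (nijenhuis_bracket N g v w)
       - N (f (\<alpha> u) (nijenhuis_bracket N g v w))"
      by (subst nijenhuis_bracket_def) (simp add: ng)
    also have "\<dots> = f (\<alpha> u) (g (N v) (N w)) + f (N (\<alpha> u)) (g v (N w)) + f (N (\<alpha> u)) (g (N v) w)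
       - f (N (\<alpha> u)) (N (g v w)) - N (f (\<alpha> u) (g v (N w))) - N (f (\<alpha> u) (g (N v) w))
       + N (f (\<alpha> u) (N (g v w)))"
      by (simp add: nijenhuis_bracket_def nl bilinear_on_space_simps[OF f(1)])
    \<comment> \<open>The identity \<open>nf\<close> applies to
      \<open>f (N (\<alpha> u)) (N (g v w))\<close>. Among the terms it produces,
      \<open>N (f (\<alpha> u) (N (g v w)))\<close> cancels the last summand above.\<close>
    finally show ?thesis unfolding nf by (simp add: comm)
  qed
  have r: "nijenhuis_bracket N f (nijenhuis_bracket N g v w) (\<alpha> u)
    = f (g (N v) (N w)) (\<alpha> u) + f (g v (N w)) (\<alpha> (N u)) + f (g (N v) w) (\<alpha> (N u))
      - N (f (g v w) (\<alpha> (N u))) - N (f (g v (N w)) (\<alpha> u)) - N (f (g (N v) w) (\<alpha> u))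
      + N (N (f (g v w) (\<alpha> u)))" for u v w
  proof -
    have "nijenhuis_bracket N f (nijenhuis_bracket N g v w) (\<alpha> u) =
       f (nijenhuis_bracket N g v w) (N (\<alpha> u)) + f (g (N v) (N w)) (\<alpha> u)
       - N (f (nijenhuis_bracket N g v w) (\<alpha> u))"
      by (subst nijenhuis_bracket_def) (simp add: ng)
    also have "\<dots> = f (g (N v) (N w)) (\<alpha> u) + f (g v (N w)) (N (\<alpha> u)) + f (g (N v) w) (N (\<alpha> u))
       - f (N (g v w)) (N (\<alpha> u)) - N (f (g v (N w)) (\<alpha> u)) - N (f (g (N v) w) (\<alpha> u))
       + N (f (N (g v w)) (\<alpha> u))"
      by (simp add: nijenhuis_bracket_def nl bilinear_on_space_simps[OF f(1)])
    finally show ?thesis unfolding nf by (simp add: comm)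
  qed
  show ?thesis
    \<comment> \<open>The instantiation unfolds only the defect on the left, so that
      \<open>l\<close> and \<open>r\<close> rewrite whole composites before the right side is
      opened.\<close>
    by (simp add: leibniz_defect_def[of _ "nijenhuis_bracket N f"] l r)
      (simp add: leibniz_defect_def defect_action2_def nl)
qed

lemma leibniz_defect_nijenhuis_deformation:
  assumes "vector_space s" "bilinear_on_space s f"
    and "nijenhuis_operator s f \<alpha> N" "nijenhuis_operator s g \<alpha> N"
  shows "leibniz_defect \<alpha> (deformed_bracket s f (nijenhuis_bracket N f) t)
      (deformed_bracket s g (nijenhuis_bracket N g) t) x y z =
    leibniz_defect \<alpha> f g x y z + s t (defect_action N (leibniz_defect \<alpha> f g) x y z)
    + s t (s t (defect_action2 N (leibniz_defect \<alpha> f g) x y z))"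
proof -
  have N: "Vector_Spaces.linear s s N" "N \<circ> \<alpha> = \<alpha> \<circ> N"
    using assms(3) by (auto simp: nijenhuis_operator_def)
  show ?thesis
    by (simp only: leibniz_defect_deformed_bracket[OF assms(1,2)
          bilinear_nijenhuis_bracket[OF assms(1) N(1) assms(2)]]
        leibniz_defect_nijenhuis_bracket_first_order[OF N assms(2)]
        leibniz_defect_nijenhuis_bracket_second_order[OF assms(2-4)])
qed

text \<open>The two undeformed defects are negatives of each other at all arguments, and both
  deformed defects arise from them by the same operator, which is odd because N is linear.\<close>

lemma nijenhuis_deformation_leibniz_defect_sum:
  assumes "vector_space s" "bilinear_on_space s f" "bilinear_on_space s g"
    and N: "nijenhuis_operator s f \<alpha> N" "nijenhuis_operator s g \<alpha> N"
    and sum0: "\<And>x y z. leibniz_defect \<alpha> f g x y z + leibniz_defect \<alpha> g f x y z = 0"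
  shows "leibniz_defect \<alpha> (deformed_bracket s f (nijenhuis_bracket N f) t)
      (deformed_bracket s g (nijenhuis_bracket N g) t) x y z
    + leibniz_defect \<alpha> (deformed_bracket s g (nijenhuis_bracket N g) t)
      (deformed_bracket s f (nijenhuis_bracket N f) t) x y z = 0"
proof -
  interpret vector_space s by fact
  have lin: "Vector_Spaces.linear s s N" using N(1) by (simp add: nijenhuis_operator_def)
  have neg: "leibniz_defect \<alpha> g f x y z = - leibniz_defect \<alpha> f g x y z" for x y z
    using sum0[of x y z] by (simp add: eq_neg_iff_add_eq_0 add.commute)
  have minus: "N (- u) = - N u" for u
    using linear_endo_simps(2)[OF lin, of 0 u] linear_endo_simps(3)[OF lin] by simp
  show ?thesis
    unfolding leibniz_defect_nijenhuis_deformation[OF assms(1,2) N]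
      leibniz_defect_nijenhuis_deformation[OF assms(1,3) N(2,1)] defect_action_def defect_action2_def neg
    by (simp add: minus linear_endo_simps[OF lin] scale_right_distrib scale_right_diff_distrib)
qed

text \<open>The Leibniz identity of a single bracket. Setting \<open>g\<close> to \<open>f\<close>
  in the sum version would only say that twice the defect vanishes.\<close>

lemma nijenhuis_deformation_leibniz_defect:
  assumes "vector_space s" "bilinear_on_space s f" "nijenhuis_operator s f \<alpha> N"
    and "\<And>x y z. leibniz_defect \<alpha> f f x y z = 0"
  shows "leibniz_defect \<alpha> (deformed_bracket s f (nijenhuis_bracket N f) t)
      (deformed_bracket s f (nijenhuis_bracket N f) t) x y z = 0"
proof -
  interpret vector_space s by fact
  have "Vector_Spaces.linear s s N" using assms(3) by (simp add: nijenhuis_operator_def)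
  from linear_endo_simps(3)[OF this] show ?thesis
    by (simp add: leibniz_defect_nijenhuis_deformation assms defect_action_def defect_action2_def)
qed

section \<open>The deformed structures are compatible Hom-Leibniz algebras\<close>

lemma nijenhuis_bracket_two_cochain:
  assumes "hom_leibniz_algebra s f \<alpha>" "nijenhuis_operator s f \<alpha> N"
  shows "nijenhuis_bracket N f \<in> two_cochains s \<alpha>"
proof -
  interpret hom_leibniz_algebra s f \<alpha> by fact
  have lin: "Vector_Spaces.linear s s N" and comm: "N (\<alpha> u) = \<alpha> (N u)" for u
    using assms(2) by (auto simp: nijenhuis_operator_def fun_eq_iff)
  \<comment> \<open>This handles the summand N f(x,y), where multiplicativity is used from right to
    left; the other two summands use it from left to right.\<close>
  have "N (f (\<alpha> x) (\<alpha> y)) = \<alpha> (N (f x y))" for x y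
    by (simp add: comm flip: multiplicative)
  then show ?thesis
    using bilinear_nijenhuis_bracket[OF vector_space_axioms lin bilinear_bracket]
    by (simp add: two_cochains_def nijenhuis_bracket_def linear_endo_simps[OF linear_twist]
        multiplicative comm)
qed

lemma hom_leibniz_algebra_nijenhuis_deformation:
  assumes "hom_leibniz_algebra s f \<alpha>" "nijenhuis_operator s f \<alpha> N"
  shows "hom_leibniz_algebra s (deformed_bracket s f (nijenhuis_bracket N f) t) \<alpha>"
proof -
  interpret hom_leibniz_algebra s f \<alpha> by fact
  let ?f = "deformed_bracket s f (nijenhuis_bracket N f) t"
  have c: "bilinear_on_space s (nijenhuis_bracket N f)"
    "\<And>x y. \<alpha> (nijenhuis_bracket N f x y) = nijenhuis_bracket N f (\<alpha> x) (\<alpha> y)"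
    using nijenhuis_bracket_two_cochain[OF assms] by (auto simp: two_cochains_def)
  have "leibniz_defect \<alpha> f f x y z = 0" for x y z
    using hom_leibniz[of x y z] by (simp add: leibniz_defect_def)
  then have d: "leibniz_defect \<alpha> ?f ?f x y z = 0" for x y z
    by (rule nijenhuis_deformation_leibniz_defect[OF vector_space_axioms bilinear_bracket assms(2)])
  show ?thesis
  proof
    show "bilinear_on_space s ?f"
      by (rule bilinear_deformed_bracket[OF vector_space_axioms bilinear_bracket c(1)])
    show "?f (\<alpha> x) (?f y z) = ?f (?f x y) (\<alpha> z) + ?f (\<alpha> y) (?f x z)" for x y z
      using d[of x y z] by (simp add: leibniz_defect_def algebra_simps)
    show "\<alpha> (?f x y) = ?f (\<alpha> x) (\<alpha> y)" for x y
      by (simp add: deformed_bracket_def linear_endo_simps[OF linear_twist] multiplicative c(2))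
  qed (simp_all add: linear_endo_simps[OF linear_twist])
qed

lemma compatible_hom_leibniz_algebra_nijenhuis_deformation:
  assumes "compatible_hom_leibniz_algebra s f g \<alpha>" "compatible_nijenhuis_operator s f g \<alpha> N"
  shows "compatible_hom_leibniz_algebra s (deformed_bracket s f (nijenhuis_bracket N f) t)
    (deformed_bracket s g (nijenhuis_bracket N g) t) \<alpha>"
proof -
  interpret compatible_hom_leibniz_algebra s f g \<alpha> by fact
  let ?f = "deformed_bracket s f (nijenhuis_bracket N f) t"
  let ?g = "deformed_bracket s g (nijenhuis_bracket N g) t"
  have N: "nijenhuis_operator s f \<alpha> N" "nijenhuis_operator s g \<alpha> N"
    using assms(2) by (auto simp: compatible_nijenhuis_operator_def)
  have "leibniz_defect \<alpha> f g x y z + leibniz_defect \<alpha> g f x y z = 0" for x y z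
    using compatible[of x y z] by (simp add: leibniz_defect_def algebra_simps)
  then have d: "leibniz_defect \<alpha> ?f ?g x y z + leibniz_defect \<alpha> ?g ?f x y z = 0" for x y z
    by (rule nijenhuis_deformation_leibniz_defect_sum[OF first.vector_space_axioms
          first.bilinear_bracket second.bilinear_bracket N])
  interpret f: hom_leibniz_algebra s ?f \<alpha>
    by (rule hom_leibniz_algebra_nijenhuis_deformation[OF first.hom_leibniz_algebra_axioms N(1)])
  interpret g: hom_leibniz_algebra s ?g \<alpha>
    by (rule hom_leibniz_algebra_nijenhuis_deformation[OF second.hom_leibniz_algebra_axioms N(2)])
  show ?thesis
  proof
    show "?f (\<alpha> x) (?g y z) + ?g (\<alpha> x) (?f y z) =
      ?f (?g x y) (\<alpha> z) + ?g (?f x y) (\<alpha> z) + ?f (\<alpha> y) (?g x z) + ?g (\<alpha> y) (?f x z)" for x y z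
      using d[of x y z] by (simp add: leibniz_defect_def algebra_simps)
  qed
qed

section \<open>Triviality via Id + tN\<close>

text \<open>Compare coefficients of t. In degree one, adding N f(x,y) to the Nijenhuis bracket
  leaves f(x,Ny) + f(Nx,y); in degree two the claim is the Nijenhuis identity.\<close>

lemma nijenhuis_deformation_hom:
  assumes "vector_space s" "bilinear_on_space s f" "nijenhuis_operator s f \<alpha> N"
  shows "deformed_bracket s f (nijenhuis_bracket N f) t x y
      + s t (N (deformed_bracket s f (nijenhuis_bracket N f) t x y))
    = f (x + s t (N x)) (y + s t (N y))"
proof -
  interpret vector_space s by fact
  have lin: "Vector_Spaces.linear s s N"
    and nij: "N (nijenhuis_bracket N f x y) = f (N x) (N y)"
    using assms(3) by (auto simp: nijenhuis_operator_def nijenhuis_bracket_def)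
  have "f x y + s t (nijenhuis_bracket N f x y) + s t (N (f x y) + s t (f (N x) (N y)))
    = f (x + s t (N x)) (y + s t (N y))"
    by (simp add: nijenhuis_bracket_def bilinear_on_space_simps[OF assms(2)]
        scale_right_distrib scale_right_diff_distrib)
  then show ?thesis
    by (simp add: deformed_bracket_def linear_endo_simps[OF lin] nij)
qed

theorem theorem5p4:
  fixes s :: "'k::field_char_0 \<Rightarrow> 'a::ab_group_add \<Rightarrow> 'a"
    and br cbr :: "'a \<Rightarrow> 'a \<Rightarrow> 'a"
    and \<alpha> N :: "'a \<Rightarrow> 'a"
    and \<mu>1 m1 :: "'a \<Rightarrow> 'a \<Rightarrow> 'a"
  assumes "compatible_hom_leibniz_algebra s br cbr \<alpha>"
    and "compatible_nijenhuis_operator s br cbr \<alpha> N"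
    and "\<And>x y. \<mu>1 x y = br x (N y) + br (N x) y - N (br x y)"
    and "\<And>x y. m1 x y = cbr x (N y) + cbr (N x) y - N (cbr x y)"
  shows "generates_infinitesimal_deformation s br cbr \<alpha> \<mu>1 m1 \<and>
         trivial_infinitesimal_deformation s br cbr \<alpha> \<mu>1 m1"
proof -
  interpret compatible_hom_leibniz_algebra s br cbr \<alpha> by fact
  have eqs: "\<mu>1 = nijenhuis_bracket N br" "m1 = nijenhuis_bracket N cbr"
    using assms(3,4) by (auto simp: fun_eq_iff nijenhuis_bracket_def)
  have N: "nijenhuis_operator s br \<alpha> N" "nijenhuis_operator s cbr \<alpha> N"
    using assms(2) by (auto simp: compatible_nijenhuis_operator_def)
  have lin: "Vector_Spaces.linear s s N" and comm: "N (\<alpha> u) = \<alpha> (N u)" for u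
    using N(1) by (auto simp: nijenhuis_operator_def fun_eq_iff)
  note deformed = compatible_hom_leibniz_algebra_nijenhuis_deformation[OF assms(1,2)]
  \<comment> \<open>The Nijenhuis operator itself witnesses triviality, with the same N for every t
    and for both brackets.\<close>
  have "compatible_hom_leibniz_hom s (deformed_bracket s br \<mu>1 t) (deformed_bracket s cbr m1 t) \<alpha>
      s br cbr \<alpha> (\<lambda>x. x + s t (N x))" for t
  proof (intro compatible_hom_leibniz_hom.intro compatible_hom_leibniz_hom_axioms.intro)
    show "compatible_hom_leibniz_algebra s (deformed_bracket s br \<mu>1 t) (deformed_bracket s cbr m1 t) \<alpha>"
      unfolding eqs by (rule deformed)
    show "compatible_hom_leibniz_algebra s br cbr \<alpha>" by fact
    show "Vector_Spaces.linear s s (\<lambda>x. x + s t (N x))"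
      by (simp add: Vector_Spaces.linear_iff first.vector_space_axioms linear_endo_simps[OF lin]
          first.scale_right_distrib mult.commute)
    show "(\<lambda>x. x + s t (N x)) \<circ> \<alpha> = \<alpha> \<circ> (\<lambda>x. x + s t (N x))"
      by (simp add: fun_eq_iff linear_endo_simps[OF first.linear_twist] comm)
  qed (simp_all only: eqs nijenhuis_deformation_hom[OF first.vector_space_axioms
        first.bilinear_bracket N(1)] nijenhuis_deformation_hom[OF first.vector_space_axioms
        second.bilinear_bracket N(2)])
  then have "trivial_infinitesimal_deformation s br cbr \<alpha> \<mu>1 m1"
    using lin by (auto simp: trivial_infinitesimal_deformation_def)
  moreover have "generates_infinitesimal_deformation s br cbr \<alpha> \<mu>1 m1"
    unfolding generates_infinitesimal_deformation_def eqs
    using assms(1) deformed nijenhuis_bracket_two_cochain[OF first.hom_leibniz_algebra_axioms N(1)]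
      nijenhuis_bracket_two_cochain[OF second.hom_leibniz_algebra_axioms N(2)]
    by blast
  ultimately show ?thesis by blast
qed

end
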